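(* Let $c>0$. Let $G$ be an $n$-vertex even-hole-free graph with $\alpha(G)=cn$, where $n$ is sufficiently large. Then $h(G)\le \frac{5n}{\log n}$.
   Context: All graphs are finite and simple; $\log$ is base $2$. $\alpha(G)$ is the independence number. A hitting set of $G$ is a set $T\subseteq V(G)$ meeting every maximum independent set of $G$; $h(G)$ is the minimum size of a hitting set. A hole is an induced cycle of length at least $4$; it is even if it has an even number of vertices; a graph is even-hole-free if it has no even hole. *)

theory Defs
  imports Complex_Main "Graph_Theory.Graph_Theory"
begin

text \<open>
  A finite simple graph is a \<^typ>\<open>'a pair_pre_digraph\<close> satisfying \<^locale>\<open>pair_graph\<close>: finite,
  loop-free and symmetric, so each undirected edge is represented by both of its orientations.
\<close>

definition indep_set :: "'a pair_pre_digraph \<Rightarrow> 'a set \<Rightarrow> bool" where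
  "indep_set G S \<longleftrightarrow> S \<subseteq> pverts G \<and> (\<forall>u\<in>S. \<forall>v\<in>S. (u, v) \<notin> parcs G)"

definition indep_number :: "'a pair_pre_digraph \<Rightarrow> nat" where
  "indep_number G = Max (card ` {S. indep_set G S})"

definition max_indep_set :: "'a pair_pre_digraph \<Rightarrow> 'a set \<Rightarrow> bool" where
  "max_indep_set G S \<longleftrightarrow> indep_set G S \<and> card S = indep_number G"

definition hitting_set :: "'a pair_pre_digraph \<Rightarrow> 'a set \<Rightarrow> bool" where
  "hitting_set G T \<longleftrightarrow> T \<subseteq> pverts G \<and> (\<forall>S. max_indep_set G S \<longrightarrow> T \<inter> S \<noteq> {})"

text \<open>
  For a finite graph with at least one vertex the vertex set itself is a hitting set, so the
  minimum below is over a finite nonempty set. The graph without vertices has no hitting set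
  (its maximum independent set is empty), and there the value is unspecified.
\<close>

definition hitting_number :: "'a pair_pre_digraph \<Rightarrow> nat" where
  "hitting_number G = Min (card ` {T. hitting_set G T})"

text \<open>
  A hole is given by listing its vertices in cyclic order. The equivalence makes the cycle
  induced: two listed vertices are adjacent exactly when they are cyclically consecutive.
\<close>

definition hole :: "'a pair_pre_digraph \<Rightarrow> 'a list \<Rightarrow> bool" where
  "hole G vs \<longleftrightarrow> length vs \<ge> 4 \<and> distinct vs \<and> set vs \<subseteq> pverts G \<and>
     (\<forall>i<length vs. \<forall>j<length vs. (vs ! i, vs ! j) \<in> parcs G \<longleftrightarrow>
        j = Suc i mod length vs \<or> i = Suc j mod length vs)"

definition even_hole_free :: "'a pair_pre_digraph \<Rightarrow> bool" where
  "even_hole_free G \<longleftrightarrow> (\<nexists>vs. hole G vs \<and> even (length vs))"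

end

theory Submission
  imports Defs
begin

text \<open>
  In an even-hole-free graph two independent sets \<open>S\<close> and \<open>T\<close> induce a forest, so there are at most
  \<open>|S| + |T|\<close> edges between them. Suppose no set of size at most \<open>k = 5n / log n\<close> is hitting, fix a
  maximum independent set \<open>S\<close>, and let \<open>Y\<close> be a union of \<open>m\<close> maximum independent sets. The vertices of
  \<open>S\<close> have on average at most \<open>2m\<close> neighbours in \<open>Y\<close>, hence some \<open>X \<subseteq> S\<close> of size about \<open>k / (2m + 1)\<close>
  has at most \<open>k\<close> vertices in \<open>X\<close> and \<open>N(X) \<inter> Y\<close> together. A maximum independent set \<open>T\<close> avoiding these
  contains at least \<open>|X|\<close> neighbours of \<open>X\<close> by maximality, all outside \<open>Y\<close>. Adding \<open>T\<close> to \<open>Y\<close> and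
  iterating gives \<open>n \<ge> \<Sum>\<^sub>m \<lfloor>k / (2m + 1)\<rfloor>\<close>, and the harmonic sum up to \<open>n\<^sup>3\<^sup>/\<^sup>4\<close> is too large for that.
\<close>

section \<open>Bipartite induced subgraphs are forests\<close>

definition induced_path :: "'a pair_pre_digraph \<Rightarrow> 'a list \<Rightarrow> bool" where
  "induced_path G vs \<longleftrightarrow> distinct vs \<and>
     (\<forall>i<length vs. \<forall>j<length vs. (vs ! i, vs ! j) \<in> parcs G \<longleftrightarrow> j = Suc i \<or> i = Suc j)"

context pair_graph
begin

lemma adj_sym: "(u, v) \<in> parcs G \<longleftrightarrow> (v, u) \<in> parcs G"
  using pair_sym_arcs by (auto simp: symmetric_def sym_def)

lemma not_adj_self: "(v, v) \<notin> parcs G"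
  using no_loops' by blast

text \<open>Minimum degree two forces an induced cycle, and the two independent sides make its
  length even. Used contrapositively: if \<open>G\<close> is even-hole-free, every nonempty
  \<open>W\<close> has a vertex with at most one neighbour in \<open>W\<close>.\<close>

lemma bipartite_even_induced_cycle:
  assumes W: "W \<noteq> {}" "W \<subseteq> S \<union> T" and S: "indep_set G S" and T: "indep_set G T"
    and deg: "\<And>v. v \<in> W \<Longrightarrow> 2 \<le> card {u \<in> W. (v, u) \<in> parcs G}"
  shows "\<exists>vs. hole G vs \<and> even (length vs)"
proof -
  have WV: "W \<subseteq> pverts G" using W S T by (auto simp: indep_set_def)
  then have finW: "finite W" using pair_finite_verts finite_subset by blast
  have bip: "(u \<in> S) \<noteq> (v \<in> S)" if "(u, v) \<in> parcs G" "u \<in> W" "v \<in> W" for u v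
    using that W(2) S T unfolding indep_set_def by blast
  \<comment> \<open>A longest induced path in \<open>W\<close> closes up to an induced cycle at a further neighbour of its end.\<close>
  define P where "P = {vs. induced_path G vs \<and> set vs \<subseteq> W \<and> vs \<noteq> []}"
  obtain w0 where "w0 \<in> W" using W by blast
  then have "[w0] \<in> P" by (auto simp: P_def induced_path_def not_adj_self)
  moreover have "length vs < Suc (card W)" if "vs \<in> P" for vs
    using that finW card_mono[of W "set vs"]
    by (auto simp: P_def induced_path_def distinct_card)
  ultimately obtain vs where vs: "vs \<in> P" and longest: "\<And>us. us \<in> P \<Longrightarrow> length us \<le> length vs"
    using ex_has_greatest_nat[of "\<lambda>vs. vs \<in> P" "[w0]" length "Suc (card W)"] by (auto simp: less_imp_le)
  have dist: "distinct vs" and vsW: "set vs \<subseteq> W" and ne: "vs \<noteq> []"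
    and adj: "\<And>i j. i < length vs \<Longrightarrow> j < length vs \<Longrightarrow>
      (vs ! i, vs ! j) \<in> parcs G \<longleftrightarrow> j = Suc i \<or> i = Suc j"
    using vs by (auto simp: P_def induced_path_def)
  have inW: "vs ! i \<in> W" if "i < length vs" for i
    using that vsW by auto
  \<comment> \<open>The guard covers the one-vertex path, where \<open>vs ! 1\<close> is
    unspecified.\<close>
  have "\<exists>w\<in>W. (vs ! 0, w) \<in> parcs G \<and> (1 < length vs \<longrightarrow> w \<noteq> vs ! 1)"
  proof (rule ccontr)
    assume "\<not> ?thesis"
    then have "{u \<in> W. (vs ! 0, u) \<in> parcs G} \<subseteq> {vs ! 1}" by auto
    then have "card {u \<in> W. (vs ! 0, u) \<in> parcs G} \<le> 1"
      using card_mono[of "{vs ! 1}"] by simp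
    moreover have "vs ! 0 \<in> W" using inW ne by simp
    ultimately show False using deg by fastforce
  qed
  then obtain w where w: "w \<in> W" "(vs ! 0, w) \<in> parcs G" "1 < length vs \<Longrightarrow> w \<noteq> vs ! 1"
    by blast
  have wvs: "w \<notin> set vs"
  proof
    assume "w \<in> set vs"
    then obtain i where "i < length vs" "w = vs ! i" by (metis in_set_conv_nth)
    then show False using w adj[of 0 i] ne by auto
  qed
  \<comment> \<open>Otherwise \<open>w # vs\<close> would be a longer induced path.\<close>
  have "\<exists>j. 1 \<le> j \<and> j < length vs \<and> (w, vs ! j) \<in> parcs G"
  proof (rule ccontr)
    assume no: "\<not> ?thesis"
    have wv: "(w, vs ! j) \<in> parcs G \<longleftrightarrow> j = 0" if "j < length vs" for j
      using no that w adj_sym by (cases j) auto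
    have "induced_path G (w # vs)"
      unfolding induced_path_def
    proof (intro conjI allI impI)
      show "distinct (w # vs)" using dist wvs by simp
    next
      fix i j assume "i < length (w # vs)" "j < length (w # vs)"
      then show "((w # vs) ! i, (w # vs) ! j) \<in> parcs G \<longleftrightarrow> j = Suc i \<or> i = Suc j"
        using wv adj adj_sym[of _ w] by (cases i; cases j) (auto simp: not_adj_self)
    qed
    then have "w # vs \<in> P" using w vsW by (auto simp: P_def)
    then show False using longest by fastforce
  qed
  \<comment> \<open>Minimality of \<open>j\<close> leaves the cycle through \<open>w\<close> and
    \<open>vs ! 0\<close>, ..., \<open>vs ! j\<close> without chords.\<close>
  then obtain j where j: "1 \<le> j" "j < length vs" "(w, vs ! j) \<in> parcs G"
    and least: "\<And>i. 1 \<le> i \<Longrightarrow> i < j \<Longrightarrow> (w, vs ! i) \<notin> parcs G"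
    using exists_least_iff[of "\<lambda>j. 1 \<le> j \<and> j < length vs \<and> (w, vs ! j) \<in> parcs G"]
    by (meson order.strict_trans)
  have par: "vs ! i \<in> S \<longleftrightarrow> (even i \<longleftrightarrow> vs ! 0 \<in> S)" if "i < length vs" for i
    using that
  proof (induction i)
    case (Suc i)
    then have "(vs ! i \<in> S) \<noteq> (vs ! Suc i \<in> S)"
      using bip[of "vs ! i" "vs ! Suc i"] adj[of i "Suc i"] inW by simp
    then show ?case using Suc by auto
  qed simp
  \<comment> \<open>Sides alternate along the path, and \<open>vs ! 0\<close> and
    \<open>vs ! j\<close> are both on the side opposite to \<open>w\<close>. So the cycle length
    \<open>j + 2\<close> is even, and at least 4 because \<open>j\<close> is positive.\<close>
  have evj: "even j"
    using par[OF j(2)] bip[OF w(2)] bip[OF j(3)] w(1) inW ne j(2) by auto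
  define cs where "cs = w # take (Suc j) vs"
  have len: "length cs = Suc (Suc j)" using j by (simp add: cs_def)
  have wv: "(w, vs ! i) \<in> parcs G \<longleftrightarrow> i = 0 \<or> i = j" if "i \<le> j" for i
    using that j(1,3) least[of i] w adj_sym by (cases "i = 0"; cases "i = j") auto
  have Suc_mod: "Suc i mod Suc (Suc j) = (if i = Suc j then 0 else Suc i)" if "i < Suc (Suc j)" for i
    using that by auto
  have "hole G cs"
    unfolding hole_def len
  proof (intro conjI allI impI)
    show "4 \<le> Suc (Suc j)" using evj j(1) by (auto elim!: evenE)
    show "distinct cs" using dist wvs by (auto simp: cs_def dest: in_set_takeD)
    show "set cs \<subseteq> pverts G" using w vsW WV by (auto simp: cs_def dest: in_set_takeD)
    fix a b assume "a < Suc (Suc j)" "b < Suc (Suc j)"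
    then show "(cs ! a, cs ! b) \<in> parcs G \<longleftrightarrow>
        b = Suc a mod Suc (Suc j) \<or> a = Suc b mod Suc (Suc j)"
      using wv adj adj_sym[of _ w] j
      by (cases a; cases b) (auto simp: cs_def not_adj_self Suc_mod)
  qed
  then show ?thesis using evj len by auto
qed

text \<open>Induction on \<open>W\<close>: deleting a vertex of degree at most one loses at most one
  edge. Orienting arcs away from \<open>S\<close> counts each edge once.\<close>

lemma card_edges_le_card_vertices:
  assumes ehf: "even_hole_free G" and S: "indep_set G S" and T: "indep_set G T"
    and "W \<subseteq> S \<union> T"
  shows "card {(u, v). (u, v) \<in> parcs G \<and> u \<in> W \<inter> S \<and> v \<in> W} \<le> card W"
proof -
  define E where "E W = {(u, v). (u, v) \<in> parcs G \<and> u \<in> W \<inter> S \<and> v \<in> W}" for W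
  have finE: "finite (E W)" for W
    by (rule finite_subset[OF _ pair_finite_arcs]) (auto simp: E_def)
  have "finite W"
    by (rule finite_subset[OF _ pair_finite_verts]) (use assms in \<open>auto simp: indep_set_def\<close>)
  then have "card (E W) \<le> card W" using assms(4)
  proof (induction "card W" arbitrary: W rule: less_induct)
    case less
    show ?case
    proof (cases "W = {}")
      case True
      then show ?thesis by (simp add: E_def)
    next
      case False
      with ehf S T less.prems obtain x
        where x: "x \<in> W" and "\<not> 2 \<le> card {u \<in> W. (x, u) \<in> parcs G}"
        using bipartite_even_induced_cycle[of W S T] unfolding even_hole_free_def by blast
      then have deg: "card {u \<in> W. (x, u) \<in> parcs G} \<le> 1" by simp
      let ?N = "{u \<in> W. (x, u) \<in> parcs G}"
      \<comment> \<open>\<open>F\<close> covers the counted arcs at \<open>x\<close>: as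
        \<open>S\<close> is independent, none of them ends at \<open>x\<close> when \<open>x\<close>
        lies in \<open>S\<close>.\<close>
      define F where "F = (if x \<in> S then Pair x ` ?N else (\<lambda>u. (u, x)) ` ?N)"
      have finN: "finite ?N" using less.prems by simp
      have "E W \<subseteq> E (W - {x}) \<union> F"
        using S adj_sym by (auto simp: E_def F_def indep_set_def)
      moreover have "finite F" "card F \<le> 1"
        using deg finN card_image_le[OF finN, of "Pair x"] card_image_le[OF finN, of "\<lambda>u. (u, x)"]
        by (auto simp: F_def)
      ultimately have "card (E W) \<le> card (E (W - {x})) + 1"
        by (meson add_left_mono card_Un_le card_mono finE finite_UnI order_trans)
      moreover have "card (E (W - {x})) \<le> card (W - {x})"
        using less.prems x by (intro less.hyps card_Diff1_less) auto
      moreover have "card W = Suc (card (W - {x}))"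
        using x less.prems by (intro card.remove) auto
      ultimately show ?thesis by linarith
    qed
  qed
  then show ?thesis by (simp add: E_def)
qed

lemma sum_degree_between_indep_sets:
  assumes ehf: "even_hole_free G" and S: "indep_set G S" and T: "indep_set G T"
  shows "(\<Sum>v\<in>S. card {u \<in> T. (v, u) \<in> parcs G}) \<le> card S + card T"
proof -
  have fin: "finite S" "finite T"
    using S T pair_finite_verts by (auto simp: indep_set_def intro: finite_subset)
  let ?E = "{(u, v). (u, v) \<in> parcs G \<and> u \<in> (S \<union> T) \<inter> S \<and> v \<in> S \<union> T}"
  have "(\<Sum>v\<in>S. card {u \<in> T. (v, u) \<in> parcs G}) = card (SIGMA v:S. {u \<in> T. (v, u) \<in> parcs G})"
    using fin by simp
  also have "\<dots> \<le> card ?E"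
    by (rule card_mono, rule finite_subset[OF _ pair_finite_arcs]) auto
  also have "\<dots> \<le> card (S \<union> T)"
    by (rule card_edges_le_card_vertices[OF ehf S T]) simp
  also have "\<dots> \<le> card S + card T" by (rule card_Un_le)
  finally show ?thesis .
qed

section \<open>Maximum independent sets avoiding a small set\<close>

lemma finite_indep_sets: "finite {S. indep_set G S}"
  by (rule finite_subset[of _ "Pow (pverts G)"]) (auto simp: indep_set_def pair_finite_verts)

lemma card_le_indep_number: "indep_set G S \<Longrightarrow> card S \<le> indep_number G"
  unfolding indep_number_def using finite_indep_sets by (intro Max_ge) auto

lemma max_indep_set_exists: "\<exists>S. max_indep_set G S"
proof -
  have "indep_number G \<in> card ` {S. indep_set G S}"
    unfolding indep_number_def
    by (rule Max_in, rule finite_imageI[OF finite_indep_sets]) (auto simp: indep_set_def)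
  then show ?thesis by (auto simp: max_indep_set_def)
qed

lemma hitting_number_le_card: "hitting_set G Z \<Longrightarrow> hitting_number G \<le> card Z"
  unfolding hitting_number_def
  by (rule Min_le, rule finite_imageI, rule finite_subset[of _ "Pow (pverts G)"])
    (auto simp: hitting_set_def pair_finite_verts)

lemma max_indep_set_avoiding:
  assumes "Z \<subseteq> pverts G" "card Z < hitting_number G"
  obtains T where "max_indep_set G T" "Z \<inter> T = {}"
  using assms hitting_number_le_card[of Z] by (auto simp: hitting_set_def)

text \<open>Exchange argument: replacing the neighbours of \<open>X\<close> in \<open>T\<close> by
  \<open>X\<close> keeps independence, so it cannot increase the size.\<close>

lemma card_le_card_neighbours_in_max_indep_set:
  assumes X: "indep_set G X" and T: "max_indep_set G T" and "X \<inter> T = {}"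
  shows "card X \<le> card {u \<in> T. \<exists>x\<in>X. (x, u) \<in> parcs G}" (is "_ \<le> card ?N")
proof -
  have indT: "indep_set G T" and cT: "card T = indep_number G"
    using T by (auto simp: max_indep_set_def)
  have fin: "finite X" "finite T"
    using X indT pair_finite_verts by (auto simp: indep_set_def intro: finite_subset)
  have "indep_set G ((T - ?N) \<union> X)"
    using X indT adj_sym by (auto simp: indep_set_def)
  then have "card ((T - ?N) \<union> X) \<le> card T"
    using card_le_indep_number cT by simp
  moreover have "card ((T - ?N) \<union> X) = card T - card ?N + card X"
    using fin assms(3) by (subst card_Un_disjoint) (auto simp: card_Diff_subset)
  moreover have "card ?N \<le> card T" using fin by (intro card_mono) auto
  ultimately show ?thesis by linarith
qed

end

text \<open>Averaging: as long as more than \<open>x\<close> elements remain and some value exceeds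
  \<open>d\<close>, deleting that element keeps the average at most \<open>d\<close>. Once no value
  exceeds \<open>d\<close>, any \<open>x\<close> elements do.\<close>

lemma exists_subset_with_small_sum:
  fixes f :: "'a \<Rightarrow> nat"
  assumes "finite S" "sum f S \<le> card S * d" "x \<le> card S"
  shows "\<exists>X\<subseteq>S. card X = x \<and> sum f X \<le> x * d"
  using assms
proof (induction "card S" arbitrary: S rule: less_induct)
  case less
  consider "card S = x" | "\<forall>v\<in>S. f v \<le> d" | v where "v \<in> S" "d < f v" "x < card S"
    using less.prems by force
  then show ?case
  proof cases
    case 1
    then show ?thesis using less.prems by blast
  next
    case 2
    obtain X where X: "X \<subseteq> S" "card X = x"
      using less.prems(3) obtain_subset_with_card_n by metis
    moreover have "sum f X \<le> x * d"
      using sum_bounded_above[of X f d] 2 X by auto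
    ultimately show ?thesis by blast
  next
    case 3
    have card: "card S = Suc (card (S - {v}))" and sum: "sum f S = f v + sum f (S - {v})"
      using 3 less.prems by (auto intro: card.remove sum.remove)
    have "\<exists>X\<subseteq>S - {v}. card X = x \<and> sum f X \<le> x * d"
    proof (rule less.hyps)
      have "sum f S \<le> Suc (card (S - {v})) * d"
        using less.prems(2) by (simp only: card[symmetric])
      then have "f v + sum f (S - {v}) \<le> d + card (S - {v}) * d"
        by (simp only: sum mult_Suc)
      then show "sum f (S - {v}) \<le> card (S - {v}) * d" using 3 by linarith
      show "card (S - {v}) < card S" "x \<le> card (S - {v})" using card 3 by linarith+
    qed (use less.prems in simp)
    then show ?thesis by blast
  qed
qed

section \<open>Greedy covering\<close>

context pair_graph
begin

text \<open>One greedy round, where \<open>d\<close> bounds the average number of neighbours in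
  \<open>Y\<close> of a vertex of \<open>S\<close>. The forest bound for \<open>S\<close> and the
  added set \<open>T\<close> contributes at most twice \<open>indep_number G\<close> edges, which
  raises \<open>d\<close> by 2.\<close>

lemma extend_cover:
  assumes ehf: "even_hole_free G" and S: "max_indep_set G S"
    and Y: "Y \<subseteq> pverts G"
    and sparse: "(\<Sum>v\<in>S. card {u \<in> Y. (v, u) \<in> parcs G}) \<le> indep_number G * d"
    and x: "x \<le> indep_number G" "x * Suc d < hitting_number G"
  shows "\<exists>Y'\<subseteq>pverts G. card Y + x \<le> card Y' \<and>
    (\<Sum>v\<in>S. card {u \<in> Y'. (v, u) \<in> parcs G}) \<le> indep_number G * (d + 2)"
proof -
  have indS: "indep_set G S" and cS: "card S = indep_number G"
    using S by (auto simp: max_indep_set_def)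
  have finS: "finite S" and finY: "finite Y" and SV: "S \<subseteq> pverts G"
    using indS Y pair_finite_verts by (auto simp: indep_set_def intro: finite_subset)
  let ?N = "\<lambda>Y v. {u \<in> Y. (v, u) \<in> parcs G}"
  obtain X where X: "X \<subseteq> S" "card X = x" "(\<Sum>v\<in>X. card (?N Y v)) \<le> x * d"
    using exists_subset_with_small_sum[OF finS, of "\<lambda>v. card (?N Y v)" d x] sparse x cS by auto
  have finX: "finite X" using X finS finite_subset by blast
  \<comment> \<open>Avoiding \<open>X\<close> makes the exchange argument apply to \<open>T\<close>;
    avoiding the neighbours of \<open>X\<close> in \<open>Y\<close> makes the neighbours found in
    \<open>T\<close> new.\<close>
  define Z where "Z = X \<union> (\<Union>v\<in>X. ?N Y v)"
  have "card Z \<le> card X + (\<Sum>v\<in>X. card (?N Y v))"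
    unfolding Z_def by (rule order_trans[OF card_Un_le add_left_mono[OF card_UN_le[OF finX]]])
  also have "\<dots> \<le> x * Suc d" using X by simp
  finally have "card Z < hitting_number G" using x by simp
  moreover have "Z \<subseteq> pverts G" using X SV Y by (auto simp: Z_def)
  ultimately obtain T where T: "max_indep_set G T" and ZT: "Z \<inter> T = {}"
    using max_indep_set_avoiding by blast
  have indT: "indep_set G T" and cT: "card T = indep_number G"
    using T by (auto simp: max_indep_set_def)
  have finT: "finite T" and TV: "T \<subseteq> pverts G"
    using indT pair_finite_verts by (auto simp: indep_set_def intro: finite_subset)
  let ?D = "{u \<in> T. \<exists>v\<in>X. (v, u) \<in> parcs G}"
  have "indep_set G X" using X indS by (auto simp: indep_set_def)
  then have "x \<le> card ?D"
    using card_le_card_neighbours_in_max_indep_set[OF _ T, of X] ZT X by (auto simp: Z_def)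
  moreover have "Y \<inter> ?D = {}" using ZT by (auto simp: Z_def)
  then have "card Y + card ?D = card (Y \<union> ?D)"
    using finY finT by (intro card_Un_disjoint[symmetric]) auto
  moreover have "card (Y \<union> ?D) \<le> card (Y \<union> T)"
    using finY finT by (intro card_mono) auto
  ultimately have "card Y + x \<le> card (Y \<union> T)" by linarith
  moreover have "(\<Sum>v\<in>S. card (?N (Y \<union> T) v)) \<le> indep_number G * (d + 2)"
  proof -
    have "card (?N (Y \<union> T) v) \<le> card (?N Y v) + card (?N T v)" for v
    proof -
      have "?N (Y \<union> T) v = ?N Y v \<union> ?N T v" by auto
      then show ?thesis by (simp only: card_Un_le)
    qed
    then have "(\<Sum>v\<in>S. card (?N (Y \<union> T) v)) \<le> (\<Sum>v\<in>S. card (?N Y v)) + (\<Sum>v\<in>S. card (?N T v))"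
      unfolding sum.distrib[symmetric] by (intro sum_mono)
    also have "\<dots> \<le> indep_number G * d + (card S + card T)"
      using sparse sum_degree_between_indep_sets[OF ehf indS indT] by (rule add_mono)
    finally show ?thesis using cS cT by simp
  qed
  ultimately show ?thesis using Y TV by (intro exI[of _ "Y \<union> T"]) auto
qed

text \<open>Round \<open>i\<close> runs \<open>extend_cover\<close> with \<open>d = 2 * i\<close>
  and the largest \<open>x\<close> satisfying \<open>x * (2 * i + 1) \<le> k\<close>. The bound of
  \<open>k\<close> by the independence number ensures that \<open>S\<close> has \<open>x\<close>
  elements to choose.\<close>

lemma sum_floor_le_card_vertices:
  fixes k :: real
  assumes ehf: "even_hole_free G" and k: "0 \<le> k" "k < hitting_number G" "k \<le> indep_number G"
  shows "(\<Sum>i<M. nat \<lfloor>k / (2 * real i + 1)\<rfloor>) \<le> card (pverts G)"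
proof -
  obtain S where S: "max_indep_set G S" using max_indep_set_exists by blast
  let ?x = "\<lambda>i. nat \<lfloor>k / (2 * real i + 1)\<rfloor>"
  have "\<exists>Y\<subseteq>pverts G. (\<Sum>i<M. ?x i) \<le> card Y \<and>
    (\<Sum>v\<in>S. card {u \<in> Y. (v, u) \<in> parcs G}) \<le> indep_number G * (2 * M)"
  proof (induction M)
    case 0
    show ?case by (intro exI[of _ "{}"]) auto
  next
    case (Suc M)
    then obtain Y where Y: "Y \<subseteq> pverts G" "(\<Sum>i<M. ?x i) \<le> card Y"
      "(\<Sum>v\<in>S. card {u \<in> Y. (v, u) \<in> parcs G}) \<le> indep_number G * (2 * M)"
      by blast
    have xk: "real (?x M) \<le> k / (2 * real M + 1)"
      using k by (intro of_nat_floor) simp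
    have "real (?x M * Suc (2 * M)) = real (?x M) * (2 * real M + 1)" by (simp add: algebra_simps)
    also have "\<dots> \<le> k" using xk by (simp add: field_simps)
    also note \<open>k < hitting_number G\<close>
    finally have hit: "?x M * Suc (2 * M) < hitting_number G" by linarith
    have "k / (2 * real M + 1) \<le> k" using k by (simp add: field_simps)
    then have "?x M \<le> indep_number G" using xk k by linarith
    from extend_cover[OF ehf S Y(1,3) this hit] obtain Y' where Y': "Y' \<subseteq> pverts G"
      "card Y + ?x M \<le> card Y'"
      "(\<Sum>v\<in>S. card {u \<in> Y'. (v, u) \<in> parcs G}) \<le> indep_number G * (2 * M + 2)"
      by blast
    then show ?case using Y(2) by (intro exI[of _ Y']) auto
  qed
  then show ?thesis using card_mono[OF pair_finite_verts] by (meson order_trans)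
qed

end

section \<open>Harmonic sums and the final estimate\<close>

lemma ln_le_sum_inverse: "ln (real M + 1) \<le> (\<Sum>i<M. 1 / (real i + 1))"
proof (induction M)
  case (Suc M)
  have "ln (real (Suc M) + 1) = ln (real M + 1) + ln (1 + 1 / (real M + 1))"
    by (subst ln_mult_pos[symmetric]) (auto simp: field_simps add_pos_nonneg)
  also have "ln (1 + 1 / (real M + 1)) \<le> 1 / (real M + 1)"
    by (rule ln_add_one_self_le_self) simp
  finally show ?case using Suc by simp
qed simp

text \<open>Each floor loses at most 1, whence the term \<open>real M\<close>; enlarging
  \<open>2 * i + 1\<close> to \<open>2 * (i + 1)\<close> leaves half a harmonic sum.\<close>

lemma sum_floor_ge:
  assumes "0 \<le> k"
  shows "k / 2 * ln (real M + 1) - real M \<le> real (\<Sum>i<M. nat \<lfloor>k / (2 * real i + 1)\<rfloor>)"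
proof -
  have "k / 2 * ln (real M + 1) - real M \<le> k / 2 * (\<Sum>i<M. 1 / (real i + 1)) - real M"
    using assms ln_le_sum_inverse[of M] by (simp add: mult_left_mono)
  also have "\<dots> = (\<Sum>i<M. k / (2 * real i + 2) - 1)"
    by (simp add: sum_distrib_left sum_subtractf distrib_left)
  also have "\<dots> \<le> (\<Sum>i<M. real (nat \<lfloor>k / (2 * real i + 1)\<rfloor>))"
  proof (rule sum_mono)
    fix i
    have "k / (2 * real i + 2) \<le> k / (2 * real i + 1)"
      using assms by (intro divide_left_mono) auto
    then show "k / (2 * real i + 2) - 1 \<le> real (nat \<lfloor>k / (2 * real i + 1)\<rfloor>)" by linarith
  qed
  finally show ?thesis by simp
qed

theorem theorem1p3:
  fixes c :: real
  assumes "c > 0"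
  shows "\<exists>N. \<forall>n\<ge>N. \<forall>G :: 'a pair_pre_digraph.
    pair_graph G \<longrightarrow> card (pverts G) = n \<longrightarrow> even_hole_free G \<longrightarrow>
    real (indep_number G) = c * real n \<longrightarrow>
    real (hitting_number G) \<le> 5 * real n / log 2 (real n)"
proof (intro exI allI impI)
  fix n and G :: "'a pair_pre_digraph"
  \<comment> \<open>The first summand gives \<open>5 / c \<le> log 2 n\<close>, hence
    \<open>k \<le> indep_number G\<close>. The second exceeds \<open>4096 = 8 ^ 4\<close>, so that
    \<open>n powr (3 / 4) < n / 8\<close>.\<close>
  assume n: "n \<ge> nat \<lceil>2 powr (5 / c)\<rceil> + 4097" and G: "pair_graph G" and card: "card (pverts G) = n"
    and ehf: "even_hole_free G" and alpha: "real (indep_number G) = c * real n"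
  interpret pair_graph G by (rule G)
  define k where "k = 5 * real n / log 2 (real n)"
  have n_large: "real n \<ge> 4097" using n by linarith
  have "2 powr (5 / c) \<le> real n" using n by linarith
  then have logc: "5 / c \<le> log 2 (real n)"
    using n_large by (subst le_log_iff) auto
  then have log_pos: "log 2 (real n) > 0" using assms by (smt (verit) divide_pos_pos)
  have "k \<le> indep_number G"
  proof -
    have "5 \<le> c * log 2 (real n)" using logc assms by (simp add: field_simps)
    then have "5 * real n \<le> c * log 2 (real n) * real n" by (rule mult_right_mono) simp
    then show ?thesis using log_pos by (simp add: k_def alpha field_simps)
  qed
  moreover have k0: "0 \<le> k" using log_pos by (simp add: k_def)
  moreover have "\<not> k < hitting_number G"
  proof
    assume "k < hitting_number G"
    \<comment> \<open>The exponent balances two demands: the main term is at least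
      \<open>15 / 8 * ln 2 * n \<ge> 9 / 8 * n\<close>, while the rounding loss \<open>M\<close>
      stays below \<open>n / 8\<close>. The difference exceeds \<open>n\<close>, a
      contradiction.\<close>
    define M where "M = nat \<lfloor>real n powr (3 / 4)\<rfloor>"
    have "k / 2 * ln (real M + 1) - real M \<le> real n"
      using sum_floor_ge[OF k0, of M]
        sum_floor_le_card_vertices[OF ehf k0 \<open>k < hitting_number G\<close> \<open>k \<le> indep_number G\<close>, of M] card
      by linarith
    moreover have "3 / 4 * ln (real n) \<le> ln (real M + 1)"
    proof -
      have "real n powr (3 / 4) \<le> real M + 1" unfolding M_def by linarith
      then have "ln (real n powr (3 / 4)) \<le> ln (real M + 1)" using n_large by (subst ln_le_cancel_iff) auto
      then show ?thesis using n_large by (simp add: ln_powr)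
    qed
    then have "k / 2 * (3 / 4 * ln (real n)) \<le> k / 2 * ln (real M + 1)"
      using k0 by (intro mult_left_mono) auto
    moreover have "k / 2 * (3 / 4 * ln (real n)) = 15 / 8 * ln 2 * real n"
      using n_large by (simp add: k_def log_def field_simps)
    moreover have "15 / 8 * ln 2 * real n \<ge> 9 / 8 * real n"
    proof -
      \<comment> \<open>The quadratic bound gives \<open>1 + 3 / 5 + 9 / 25 = 49 / 25\<close>; the
        value \<open>3 / 5\<close> is what turns \<open>15 / 8 * ln 2\<close> into
        \<open>9 / 8\<close>.\<close>
      have "exp (3 / 5 :: real) \<le> 2"
        using exp_bound[of "3 / 5"] by (simp add: power2_eq_square)
      then have "3 / 5 \<le> ln (2 :: real)" by (subst ln_ge_iff) auto
      then show ?thesis by (intro mult_right_mono) auto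
    qed
    moreover have "real M < real n / 8"
    proof -
      have "real M \<le> real n powr (3 / 4)" unfolding M_def by simp
      also have "\<dots> = real n * real n powr (- 1 / 4)"
        using n_large by (simp add: powr_mult_base)
      also have "\<dots> < real n * 4096 powr (- 1 / 4)"
        using n_large by (intro mult_strict_left_mono powr_less_mono2_neg) auto
      also have "(4096 :: real) powr (- 1 / 4) = (8 powr 4) powr (- 1 / 4)" by simp
      also have "\<dots> = 1 / 8" unfolding powr_powr by (simp add: powr_minus_divide)
      finally show ?thesis by simp
    qed
    ultimately show False by linarith
  qed
  ultimately show "real (hitting_number G) \<le> 5 * real n / log 2 (real n)"
    by (simp add: k_def)
qed

end
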